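(* Let $X$ be a set and let $f$ be a complementary choice function on $X$. Let $St(f)=\{A\subseteq X : f(A)=A\}$. Then $$f=\bigcup_{K\in St(f)} f_K,$$ that is, $f(A)=\bigcup_{K\in St(f)} f_K(A)$ for every $A\subseteq X$.
   Context: A choice function (CF) on a set $X$ is a map $f:2^X\to 2^X$ with $f(A)\subseteq A$ for all $A\subseteq X$. A CF $f$ is consistent if $f(A)\subseteq B\subseteq A$ implies $f(B)=f(A)$; it is monotonic if $A\subseteq B$ implies $f(A)\subseteq f(B)$; it is complementary if it is both consistent and monotonic. For $K\subseteq X$, the packaged CF $f_K$ is defined by $f_K(A)=K$ if $K\subseteq A$ and $f_K(A)=\emptyset$ otherwise. *)

theory Defs
  imports Main
begin

text \<open>
  A choice function on a set \<open>X\<close> is a map from the power set of \<open>X\<close> to itself. It is represented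
  by a total function on sets of which only the values on subsets of \<open>X\<close> are meaningful; all
  quantifiers over sets are therefore restricted to subsets of \<open>X\<close>.
\<close>

definition choice_function :: "'a set \<Rightarrow> ('a set \<Rightarrow> 'a set) \<Rightarrow> bool" where
  "choice_function X f \<longleftrightarrow> (\<forall>A. A \<subseteq> X \<longrightarrow> f A \<subseteq> A)"

definition consistent_cf :: "'a set \<Rightarrow> ('a set \<Rightarrow> 'a set) \<Rightarrow> bool" where
  "consistent_cf X f \<longleftrightarrow> (\<forall>A B. A \<subseteq> X \<longrightarrow> f A \<subseteq> B \<longrightarrow> B \<subseteq> A \<longrightarrow> f B = f A)"

definition monotonic_cf :: "'a set \<Rightarrow> ('a set \<Rightarrow> 'a set) \<Rightarrow> bool" where
  "monotonic_cf X f \<longleftrightarrow> (\<forall>A B. A \<subseteq> B \<longrightarrow> B \<subseteq> X \<longrightarrow> f A \<subseteq> f B)"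

definition complementary_cf :: "'a set \<Rightarrow> ('a set \<Rightarrow> 'a set) \<Rightarrow> bool" where
  "complementary_cf X f \<longleftrightarrow> choice_function X f \<and> consistent_cf X f \<and> monotonic_cf X f"

definition packaged_cf :: "'a set \<Rightarrow> 'a set \<Rightarrow> 'a set" where
  "packaged_cf K A = (if K \<subseteq> A then K else {})"

definition St :: "'a set \<Rightarrow> ('a set \<Rightarrow> 'a set) \<Rightarrow> 'a set set" where
  "St X f = {A. A \<subseteq> X \<and> f A = A}"

end

theory Submission
  imports Defs
begin

text \<open>
  Consistency makes \<open>f A\<close> itself a fixed point, so it occurs among the packages contained in \<open>A\<close>;
  monotonicity puts every fixed point \<open>K \<subseteq> A\<close> inside \<open>f A\<close>.
\<close>

theorem theorem1:
  fixes X :: "'a set" and f :: "'a set \<Rightarrow> 'a set"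
  assumes "complementary_cf X f"
  shows "\<forall>A. A \<subseteq> X \<longrightarrow> f A = (\<Union>K\<in>St X f. packaged_cf K A)"
proof (intro allI impI equalityI)
  fix A assume A: "A \<subseteq> X"
  have sub: "f A \<subseteq> A"
    using assms A by (simp add: complementary_cf_def choice_function_def)
  \<comment> \<open>Consistency is instantiated with \<open>B = f A\<close>: its two side conditions
    become the trivial \<open>f A \<subseteq> f A\<close> and \<open>f A \<subseteq> A\<close>,
    which is \<open>sub\<close>.\<close>
  moreover have "f (f A) = f A"
    using assms A sub unfolding complementary_cf_def consistent_cf_def by blast
  ultimately have "f A \<in> St X f" "packaged_cf (f A) A = f A"
    using A by (auto simp: St_def packaged_cf_def)
  then show "f A \<subseteq> (\<Union>K\<in>St X f. packaged_cf K A)"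
    by blast
next
  fix A assume A: "A \<subseteq> X"
  \<comment> \<open>Restricting to \<open>K \<subseteq> A\<close> loses nothing: for any other
    \<open>K\<close>, \<open>packaged_cf K A\<close> takes its default value \<open>{}\<close> and
    adds no element to the union.\<close>
  have "K \<subseteq> f A" if "K \<in> St X f" "K \<subseteq> A" for K
  proof -
    have "f K \<subseteq> f A"
      using assms A \<open>K \<subseteq> A\<close> by (simp add: complementary_cf_def monotonic_cf_def)
    then show ?thesis
      using \<open>K \<in> St X f\<close> by (simp add: St_def)
  qed
  then show "(\<Union>K\<in>St X f. packaged_cf K A) \<subseteq> f A"
    by (auto simp: packaged_cf_def split: if_splits)
qed

end
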